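(* Any deterministic non-clairvoyant algorithm is $\Omega(\ln^{1/\alpha}P)$-competitive with respect to total flow time plus energy: there is a constant $c>0$ depending only on $\alpha$ such that for every $P\ge 2$ and every deterministic non-clairvoyant algorithm $A$ on $P$ processors, there exists a job set $\mathcal{J}$ with $G_A(\mathcal{J})\ge c\,(\ln P)^{1/\alpha}\, G^*(\mathcal{J})$.
   Context: Model: there are $P$ processors whose speeds can be set individually at every time; a processor running at speed $s\ge 0$ consumes power $s^\alpha$, where $\alpha>1$ is a fixed constant. A job set $\mathcal{J}=\{J_1,\dots,J_n\}$: each job $J_i$ has a release time $r_i\ge0$ and a sequence of phases $J_i^1,\dots,J_i^{k_i}$ executed in order; phase $J_i^k$ has work $w_i^k>0$ and parallelism $h_i^k\in[1,\infty]$. If at time $t$ job $J_i$ is in phase $k$ and is allocated $a_i(t)$ processors with speeds $s_1\ge\dots\ge s_{a_i(t)}$, its execution rate is $\sum_{j=1}^{\min\{a_i(t),h_i^k\}}s_j$. A valid schedule uses disjoint processor sets with $\sum_i a_i(t)\le P$, unallocated processors have speed $0$, no job runs before its release, phases run in order, and each job completes at finite time $c_i$. $F(\mathcal{J})=\sum_i(c_i-r_i)$, $E(\mathcal{J})=\int_0^\infty u_t\,dt$ with $u_t$ the total power at time $t$, and $G=F+E$; $G_A$ is its value under algorithm $A$ and $G^*$ the minimum over all valid schedules. An algorithm is non-clairvoyant if it makes all scheduling decisions without any current or future information about the jobs, such as their parallelism profiles and remaining work (it only observes which jobs are currently active). *)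

theory Defs
  imports "HOL-Analysis.Analysis"
begin

record phase =
  work :: real
  parallelism :: ereal

record job =
  release :: real
  phases :: "phase list"

text \<open>A job set \<open>J\<^sub>1, \<dots>, J\<^sub>n\<close> is a list; its indices \<open>0, \<dots>, n - 1\<close> are the names of the jobs.\<close>

definition valid_job :: "job \<Rightarrow> bool" where
  "valid_job j \<longleftrightarrow> 0 \<le> release j \<and> phases j \<noteq> [] \<and>
     (\<forall>f \<in> set (phases j). 0 < work f \<and> 1 \<le> parallelism f)"

definition job_set :: "job list \<Rightarrow> bool" where
  "job_set J \<longleftrightarrow> J \<noteq> [] \<and> (\<forall>j \<in> set J. valid_job j)"

text \<open>\<open>assign S p t\<close> is the job to which processor \<open>p\<close> is allocated at time \<open>t\<close>, if any.  Allocating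
  processors to jobs in this way makes the processor sets of distinct jobs disjoint and bounds
  the total allocation by the number \<open>P\<close> of processors, which are named \<open>0, \<dots>, P - 1\<close>.\<close>

record schedule =
  assign :: "nat \<Rightarrow> real \<Rightarrow> nat option"
  speed :: "nat \<Rightarrow> real \<Rightarrow> real"

definition speeds_desc :: "nat \<Rightarrow> schedule \<Rightarrow> nat \<Rightarrow> real \<Rightarrow> real list" where
  "speeds_desc P S i t =
     rev (sort (map (\<lambda>p. speed S p t) (filter (\<lambda>p. assign S p t = Some i) [0..<P])))"

text \<open>The rate of job \<open>i\<close> at time \<open>t\<close> if it is in a phase of parallelism \<open>h\<close>: the sum of \<open>s\<^sub>j\<close> over
  the integers \<open>j\<close> with \<open>1 \<le> j \<le> min {a, h}\<close>, where \<open>a\<close> is the number of processors allocated.\<close>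

definition exec_rate :: "nat \<Rightarrow> schedule \<Rightarrow> nat \<Rightarrow> ereal \<Rightarrow> real \<Rightarrow> real" where
  "exec_rate P S i h t =
     (let s = speeds_desc P S i t
      in \<Sum>j \<in> {j::nat. 1 \<le> j \<and> ereal (real j) \<le> min (ereal (real (length s))) h}. s ! (j - 1))"

text \<open>\<open>phase_end P J S i k\<close> is the time at which the first \<open>k\<close> phases of job \<open>i\<close> are finished:
  phase \<open>k + 1\<close> starts when phase \<open>k\<close> ends and ends as soon as its work has been
  executed.  The value is \<open>\<infinity>\<close> if that never happens.\<close>

primrec phase_end :: "nat \<Rightarrow> job list \<Rightarrow> schedule \<Rightarrow> nat \<Rightarrow> nat \<Rightarrow> ereal" where
  "phase_end P J S i 0 = ereal (release (J ! i))"
| "phase_end P J S i (Suc k) =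
     (let a = phase_end P J S i k; f = phases (J ! i) ! k
      in INF t \<in> {t::real. a \<le> ereal t \<and>
              ennreal (work f) \<le>
                (\<integral>\<^sup>+u \<in> {real_of_ereal a..t}. ennreal (exec_rate P S i (parallelism f) u) \<partial>lborel)}.
           ereal t)"

definition completion :: "nat \<Rightarrow> job list \<Rightarrow> schedule \<Rightarrow> nat \<Rightarrow> ereal" where
  "completion P J S i = phase_end P J S i (length (phases (J ! i)))"

definition active :: "nat \<Rightarrow> job list \<Rightarrow> schedule \<Rightarrow> real \<Rightarrow> nat set" where
  "active P J S t =
     {i. i < length J \<and> release (J ! i) \<le> t \<and> ereal t < completion P J S i}"

definition valid_schedule :: "nat \<Rightarrow> job list \<Rightarrow> schedule \<Rightarrow> bool" where
  "valid_schedule P J S \<longleftrightarrow>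
     (\<forall>p<P. speed S p \<in> borel_measurable borel) \<and>
     (\<forall>p<P. \<forall>i. {t. assign S p t = Some i} \<in> sets borel) \<and>
     (\<forall>p<P. \<forall>t. 0 \<le> speed S p t) \<and>
     (\<forall>p<P. \<forall>t. assign S p t = None \<longrightarrow> speed S p t = 0) \<and>
     (\<forall>p<P. \<forall>t i. assign S p t = Some i \<longrightarrow> i < length J \<and> release (J ! i) \<le> t) \<and>
     (\<forall>i<length J. completion P J S i < \<infinity>)"

definition flow_time :: "nat \<Rightarrow> job list \<Rightarrow> schedule \<Rightarrow> ereal" where
  "flow_time P J S = (\<Sum>i<length J. completion P J S i - ereal (release (J ! i)))"

definition total_power :: "real \<Rightarrow> nat \<Rightarrow> schedule \<Rightarrow> real \<Rightarrow> real" where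
  "total_power \<alpha> P S t = (\<Sum>p<P. speed S p t powr \<alpha>)"

definition energy :: "real \<Rightarrow> nat \<Rightarrow> schedule \<Rightarrow> ennreal" where
  "energy \<alpha> P S = (\<integral>\<^sup>+t \<in> {0..}. ennreal (total_power \<alpha> P S t) \<partial>lborel)"

definition cost :: "real \<Rightarrow> nat \<Rightarrow> job list \<Rightarrow> schedule \<Rightarrow> ereal" where
  "cost \<alpha> P J S = flow_time P J S + enn2ereal (energy \<alpha> P S)"

definition opt_cost :: "real \<Rightarrow> nat \<Rightarrow> job list \<Rightarrow> ereal" where
  "opt_cost \<alpha> P J = (INF S \<in> {S. valid_schedule P J S}. cost \<alpha> P J S)"

text \<open>A deterministic algorithm maps every job set to the schedule it produces.\<close>

definition algorithm :: "nat \<Rightarrow> (job list \<Rightarrow> schedule) \<Rightarrow> bool" where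
  "algorithm P A \<longleftrightarrow> (\<forall>J. job_set J \<longrightarrow> valid_schedule P J (A J))"

text \<open>The decisions at time \<open>t\<close> may depend only on which jobs have been active at the times up to
  and including \<open>t\<close>: two job sets that give rise to the same observations up to \<open>t\<close> are
  treated identically at time \<open>t\<close>.\<close>

definition nonclairvoyant :: "nat \<Rightarrow> (job list \<Rightarrow> schedule) \<Rightarrow> bool" where
  "nonclairvoyant P A \<longleftrightarrow>
     (\<forall>J J' t. job_set J \<longrightarrow> job_set J' \<longrightarrow> 0 \<le> t \<longrightarrow>
        (\<forall>u \<in> {0..t}. active P J (A J) u = active P J' (A J') u) \<longrightarrow>
        (\<forall>p<P. assign (A J) p t = assign (A J') p t \<and> speed (A J) p t = speed (A J') p t))"

end

theory Submission imports Defs begin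

text \<open>A single job with a single phase suffices.  Until that job completes, the algorithm sees nothing,
  so its speeds are a fixed function of time.  Let \<open>T\<close> be the time at which it finishes unit work of
  parallelism 1, \<open>E\<close> the energy it spends until then, and \<open>W\<^sub>h\<close> the work that parallelism \<open>h\<close> would
  extract from the same speeds by time \<open>T\<close>.  On a job of work \<open>W\<^sub>h\<close> and parallelism \<open>h\<close> the algorithm
  pays at least \<open>T + E\<close>, whereas the optimum is at most \<open>2 W\<^sub>h h powr (1 / \<alpha> - 1)\<close>.  If the ratio were
  small for every \<open>h \<le> P\<close>, all the prefix sums \<open>W\<^sub>h\<close> of the integrated ranked speeds would be large,
  and summing tangent lines of \<open>s powr \<alpha>\<close> would give \<open>E\<close> a lower bound proportional to
  \<open>1 + 1 / 2 + \<dots> + 1 / P \<ge> ln P\<close>, which exceeds \<open>E\<close>.\<close>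

section \<open>Speeds of one job in decreasing order\<close>

text \<open>Padding with 0 beyond the allocated processors lets every sum range over a fixed index
  set, however many processors are allocated at time \<open>t\<close>. The index \<open>j\<close>
  counts from 0.\<close>

definition ranked_speed :: "nat \<Rightarrow> schedule \<Rightarrow> nat \<Rightarrow> nat \<Rightarrow> real \<Rightarrow> real" where
  "ranked_speed P S i j t =
     (if j < length (speeds_desc P S i t) then speeds_desc P S i t ! j else 0)"

lemma length_speeds_desc_le: "length (speeds_desc P S i t) \<le> P"
  unfolding speeds_desc_def
  by simp (metis diff_zero length_filter_le length_upt)

lemma set_speeds_desc:
  "set (speeds_desc P S i t) = {speed S p t |p. p < P \<and> assign S p t = Some i}"
  unfolding speeds_desc_def by auto

lemma ranked_speed_nonneg:
  assumes "\<And>p. p < P \<Longrightarrow> 0 \<le> speed S p t"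
  shows "0 \<le> ranked_speed P S i j t"
proof -
  have "\<forall>x \<in> set (speeds_desc P S i t). 0 \<le> x"
    unfolding set_speeds_desc using assms by auto
  then show ?thesis
    by (simp add: ranked_speed_def)
qed

text \<open>The zero padding absorbs the minimum with the number of allocated processors. Changing
  the parallelism thus only changes the length of a prefix sum over one fixed family of
  functions.\<close>

lemma exec_rate_eq_sum_ranked_speed:
  "exec_rate P S i (ereal (real h)) t = (\<Sum>j<h. ranked_speed P S i j t)"
proof -
  define s where "s = speeds_desc P S i t"
  have "{j::nat. 1 \<le> j \<and> ereal (real j) \<le> min (ereal (real (length s))) (ereal (real h))}
      = Suc ` {..<min (length s) h}"
    by (auto simp: image_iff Suc_le_eq gr0_conv_Suc)
  then have "exec_rate P S i (ereal (real h)) t = (\<Sum>j<min (length s) h. s ! j)"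
    unfolding exec_rate_def Let_def s_def[symmetric] by (simp add: sum.reindex)
  also have "\<dots> = (\<Sum>j<h. if j < length s then s ! j else 0)"
    by (rule sum.mono_neutral_cong_left) auto
  finally show ?thesis
    by (simp only: ranked_speed_def s_def)
qed

text \<open>In a decreasing list the entries above a threshold form a prefix. This reduces a
  condition on a sorted list to counting, which sorting does not affect.\<close>

lemma nth_less_iff_length_filter:
  fixes x :: real
  assumes "sorted_wrt (\<ge>) s" "j < length s"
  shows "x < s ! j \<longleftrightarrow> j < length (filter (\<lambda>y. x < y) s)"
  using assms
proof (induction s arbitrary: j)
  case (Cons a s)
  show ?case
  proof (cases "x < a")
    case True
    then show ?thesis
      using Cons by (cases j) auto
  next
    case False
    then have "\<forall>y \<in> set (a # s). \<not> x < y"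
      using Cons.prems by auto
    then show ?thesis
      using nth_mem[OF Cons.prems(2)] filter_False[of "a # s" "\<lambda>y. x < y"] by auto
  qed
qed simp

lemma length_filter_speeds_desc:
  "length (filter Q (speeds_desc P S i t))
    = card {p. p < P \<and> assign S p t = Some i \<and> Q (speed S p t)}"
proof -
  have "length (filter Q (speeds_desc P S i t)) = size (filter_mset Q (mset (speeds_desc P S i t)))"
    by (simp only: mset_filter[symmetric] size_mset)
  also have "mset (speeds_desc P S i t)
      = mset (map (\<lambda>p. speed S p t) (filter (\<lambda>p. assign S p t = Some i) [0..<P]))"
    by (simp add: speeds_desc_def)
  also have "size (filter_mset Q \<dots>)
      = length (filter (\<lambda>p. assign S p t = Some i \<and> Q (speed S p t)) [0..<P])"
    by (simp only: mset_filter[symmetric] size_mset filter_map comp_def length_map filter_filter)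
  also have "\<dots> = card (set (filter (\<lambda>p. assign S p t = Some i \<and> Q (speed S p t)) [0..<P]))"
    by (intro distinct_card[symmetric]) auto
  finally show ?thesis
    by (simp add: conj_assoc)
qed

text \<open>Counting avoids reasoning about sorting: the ranked speed exceeds \<open>x\<close>
  exactly when more than \<open>j\<close> processors of the job do, and this is a finite union, over
  sets of processors, of finite intersections of Borel sets.\<close>

lemma borel_measurable_ranked_speed:
  assumes "\<And>p. p < P \<Longrightarrow> speed S p \<in> borel_measurable borel"
    and "\<And>p. p < P \<Longrightarrow> {t. assign S p t = Some i} \<in> sets borel"
    and "\<And>p t. p < P \<Longrightarrow> 0 \<le> speed S p t"
  shows "ranked_speed P S i j \<in> borel_measurable borel"
proof (rule borel_measurableI_greater)
  fix x
  \<comment> \<open>For negative \<open>x\<close> the padding zeros also exceed \<open>x\<close>, so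
    counting is valid only for \<open>0 \<le> x\<close>; for negative \<open>x\<close> the set is
    the whole line.\<close>
  have count: "x < ranked_speed P S i j t \<longleftrightarrow>
      j < card {p. p < P \<and> assign S p t = Some i \<and> x < speed S p t}" if "0 \<le> x" for t
  proof (cases "j < length (speeds_desc P S i t)")
    case True
    have "sorted_wrt (\<ge>) (speeds_desc P S i t)"
      unfolding speeds_desc_def by (simp add: sorted_wrt_rev)
    with True show ?thesis
      by (simp add: ranked_speed_def nth_less_iff_length_filter length_filter_speeds_desc)
  next
    case False
    then have "\<not> j < length (filter (\<lambda>y. x < y) (speeds_desc P S i t))"
      using length_filter_le[of "\<lambda>y. x < y" "speeds_desc P S i t"] by linarith
    with False that show ?thesis
      by (simp add: ranked_speed_def length_filter_speeds_desc)
  qed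
  show "{t \<in> space borel. x < ranked_speed P S i j t} \<in> sets borel"
  proof (cases "0 \<le> x")
    case True
    define B where "B p = {t. assign S p t = Some i \<and> x < speed S p t}" for p
    have B: "B p \<in> sets borel" if "p < P" for p
    proof -
      have "B p = {t. assign S p t = Some i} \<inter> {t \<in> space borel. x < speed S p t}"
        by (auto simp: B_def)
      moreover have "{t \<in> space borel. x < speed S p t} \<in> sets borel"
        using assms(1)[OF that] by measurable
      ultimately show ?thesis
        using assms(2)[OF that] by auto
    qed
    have "{t \<in> space borel. x < ranked_speed P S i j t}
        = (\<Union>A \<in> {A. A \<subseteq> {..<P} \<and> j < card A}. \<Inter>p \<in> A. B p)"
    proof (intro set_eqI iffI)
      fix t assume "t \<in> {t \<in> space borel. x < ranked_speed P S i j t}"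
      then show "t \<in> (\<Union>A \<in> {A. A \<subseteq> {..<P} \<and> j < card A}. \<Inter>p \<in> A. B p)"
        using count[OF True, of t]
        by (intro UN_I[of "{p. p < P \<and> assign S p t = Some i \<and> x < speed S p t}"])
           (auto simp: B_def)
    next
      fix t assume "t \<in> (\<Union>A \<in> {A. A \<subseteq> {..<P} \<and> j < card A}. \<Inter>p \<in> A. B p)"
      then obtain A where A: "A \<subseteq> {..<P}" "j < card A" "\<And>p. p \<in> A \<Longrightarrow> t \<in> B p"
        by blast
      have "card A \<le> card {p. p < P \<and> assign S p t = Some i \<and> x < speed S p t}"
        using A by (intro card_mono) (auto simp: B_def)
      with A(2) show "t \<in> {t \<in> space borel. x < ranked_speed P S i j t}"
        using count[OF True, of t] by simp
    qed
    also have "\<dots> \<in> sets borel"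
    proof (rule sets.finite_UN)
      fix A assume A: "A \<in> {A. A \<subseteq> {..<P} \<and> j < card A}"
      then have "A \<noteq> {}" "finite A"
        by (auto intro: finite_subset)
      with A show "(\<Inter>p \<in> A. B p) \<in> sets borel"
        using B by (intro sets.finite_INT) auto
    qed simp
    finally show ?thesis .
  next
    case False
    moreover have "0 \<le> ranked_speed P S i j t" for t
      using assms(3) by (rule ranked_speed_nonneg)
    ultimately have "x < ranked_speed P S i j t" for t
      by (meson less_le_trans not_le)
    then show ?thesis
      by simp
  qed
qed

lemma sum_list_eq_sum_nth_padded:
  assumes "length xs \<le> n"
  shows "sum_list (map f xs) = (\<Sum>j<n. if j < length xs then f (xs ! j) else (0::real))"
proof -
  have "sum_list (map f xs) = (\<Sum>j<length xs. f (xs ! j))"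
    by (simp add: sum_list_sum_nth atLeast0LessThan)
  also have "\<dots> = (\<Sum>j<n. if j < length xs then f (xs ! j) else 0)"
    using assms by (intro sum.mono_neutral_cong_left) auto
  finally show ?thesis .
qed

text \<open>Sorting permutes the summands, and the padding adds only
  \<open>0 powr \<alpha> = 0\<close>. The hypothesis holds when job \<open>i\<close> is the only
  job.\<close>

lemma total_power_eq_sum_ranked_speed:
  assumes "\<And>p. p < P \<Longrightarrow> assign S p t \<noteq> Some i \<Longrightarrow> speed S p t = 0"
  shows "total_power \<alpha> P S t = (\<Sum>j<P. ranked_speed P S i j t powr \<alpha>)"
proof -
  have "total_power \<alpha> P S t = (\<Sum>p | p < P \<and> assign S p t = Some i. speed S p t powr \<alpha>)"
    unfolding total_power_def using assms by (intro sum.mono_neutral_right) auto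
  also have "\<dots> = sum_list (map (\<lambda>p. speed S p t powr \<alpha>)
      (filter (\<lambda>p. assign S p t = Some i) [0..<P]))"
    by (subst sum_list_distinct_conv_sum_set) (auto intro: sum.cong)
  also have "\<dots> = sum_list (map (\<lambda>x. x powr \<alpha>)
      (map (\<lambda>p. speed S p t) (filter (\<lambda>p. assign S p t = Some i) [0..<P])))"
    by (simp add: comp_def)
  also have "\<dots> = sum_list (map (\<lambda>x. x powr \<alpha>) (speeds_desc P S i t))"
    by (simp only: speeds_desc_def sum_mset_sum_list[symmetric] mset_map mset_rev mset_sort)
  also have "\<dots> = (\<Sum>j<P. ranked_speed P S i j t powr \<alpha>)"
    unfolding ranked_speed_def
    by (subst sum_list_eq_sum_nth_padded[OF length_speeds_desc_le]) (auto intro: sum.cong)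
  finally show ?thesis .
qed

section \<open>Tangent inequalities and harmonic sums\<close>

lemma powr_le_tangent_at_one:
  fixes x \<gamma> :: real
  assumes "0 \<le> x" "0 < \<gamma>" "\<gamma> < 1"
  shows "x powr \<gamma> \<le> 1 + \<gamma> * (x - 1)"
proof (cases "x = 0")
  case False
  then show ?thesis
    using Youngs_inequality_0[of \<gamma> "1 - \<gamma>" x 1] assms by (simp add: algebra_simps)
qed (use assms in auto)

text \<open>Convexity of the power function, obtained from Young's inequality for \<open>s\<close>
  and \<open>y powr (\<alpha> - 1)\<close>: the conjugate exponent \<open>q\<close> satisfies
  \<open>(\<alpha> - 1) * q = \<alpha>\<close>.\<close>

lemma powr_ge_tangent:
  fixes \<alpha> s y :: real
  assumes "1 < \<alpha>" "0 \<le> s" "0 \<le> y"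
  shows "(1 - \<alpha>) * y powr \<alpha> + \<alpha> * y powr (\<alpha> - 1) * s \<le> s powr \<alpha>"
proof -
  define q where "q = \<alpha> / (\<alpha> - 1)"
  have q: "1 < q" "1 / \<alpha> + 1 / q = 1" "(\<alpha> - 1) * q = \<alpha>"
    using assms by (auto simp: q_def field_simps)
  have "s * y powr (\<alpha> - 1) \<le> s powr \<alpha> / \<alpha> + y powr \<alpha> / q"
    using Youngs_inequality[OF assms(1) q(1,2) assms(2), of "y powr (\<alpha> - 1)"]
    by (simp add: powr_powr q)
  then have "\<alpha> * (s * y powr (\<alpha> - 1)) \<le> \<alpha> * (s powr \<alpha> / \<alpha> + y powr \<alpha> / q)"
    using assms by (intro mult_left_mono) auto
  also have "\<dots> = s powr \<alpha> + (\<alpha> - 1) * y powr \<alpha>"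
    using assms by (simp add: q_def field_simps)
  finally show ?thesis
    by (simp add: algebra_simps)
qed

lemma harm_eq_sum_lessThan: "harm n = (\<Sum>j<n. 1 / real (Suc j))"
  unfolding harm_def by (simp add: sum.atLeast1_atMost_eq inverse_eq_divide)

text \<open>The tangent points \<open>\<beta> j powr (- 1 / \<alpha>)\<close> are, up to a constant, the speeds that serve every
  parallelism equally well; their total power is a harmonic sum.\<close>

lemma sum_powr_ge_weighted_sum:
  fixes \<alpha> \<beta> :: real and s :: "nat \<Rightarrow> real"
  assumes "1 < \<alpha>" "0 < \<beta>" "\<And>j. 0 \<le> s j"
  shows "(1 - \<alpha>) * \<beta> powr \<alpha> * harm n
      + \<alpha> * \<beta> powr (\<alpha> - 1) * (\<Sum>j<n. real (Suc j) powr (1 / \<alpha> - 1) * s j)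
    \<le> (\<Sum>j<n. s j powr \<alpha>)"
proof -
  have "(1 - \<alpha>) * \<beta> powr \<alpha> * (1 / real (Suc j))
      + \<alpha> * \<beta> powr (\<alpha> - 1) * (real (Suc j) powr (1 / \<alpha> - 1) * s j) \<le> s j powr \<alpha>" for j
  proof -
    define y where "y = \<beta> * real (Suc j) powr (- 1 / \<alpha>)"
    have y: "0 \<le> y"
      using assms by (simp add: y_def)
    have "y powr \<alpha> = \<beta> powr \<alpha> * (1 / real (Suc j))"
      using assms by (simp add: y_def powr_mult powr_divide powr_powr powr_minus_divide)
    moreover have "(- 1 / \<alpha>) * (\<alpha> - 1) = 1 / \<alpha> - 1"
      using assms by (simp add: field_simps)
    then have "y powr (\<alpha> - 1) = \<beta> powr (\<alpha> - 1) * real (Suc j) powr (1 / \<alpha> - 1)"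
      using assms by (simp add: y_def powr_mult powr_powr)
    ultimately show ?thesis
      using powr_ge_tangent[OF assms(1) assms(3)[of j] y] by (simp add: mult_ac)
  qed
  then have "(\<Sum>j<n. (1 - \<alpha>) * \<beta> powr \<alpha> * (1 / real (Suc j))
      + \<alpha> * \<beta> powr (\<alpha> - 1) * (real (Suc j) powr (1 / \<alpha> - 1) * s j)) \<le> (\<Sum>j<n. s j powr \<alpha>)"
    by (rule sum_mono)
  then show ?thesis
    by (simp add: sum.distrib harm_eq_sum_lessThan sum_distrib_left)
qed

text \<open>Abel summation as an induction: each prefix sum is nonnegative, so lowering the common
  weight of a prefix to the next weight can only decrease the total. The weights themselves may have
  any sign.\<close>

lemma antimono_weighted_sum_ge:
  fixes b z :: "nat \<Rightarrow> real"
  assumes "antimono b" "\<And>h. h \<le> n \<Longrightarrow> 0 \<le> (\<Sum>j<h. z j)"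
  shows "b n * (\<Sum>j<n. z j) \<le> (\<Sum>j<n. b j * z j)"
  using assms(2)
proof (induction n)
  case (Suc n)
  have "b (Suc n) * (\<Sum>j<Suc n. z j) \<le> b n * (\<Sum>j<Suc n. z j)"
    using assms(1) Suc.prems[of "Suc n"] by (intro mult_right_mono) (auto simp: antimono_def)
  also have "\<dots> \<le> (\<Sum>j<Suc n. b j * z j)"
    using Suc by (simp add: algebra_simps)
  finally show ?case .
qed simp

text \<open>The extremal sequence \<open>x\<close> has prefix sums exactly
  \<open>K * h powr \<gamma>\<close>. Since the weights decrease, Abel summation shows that no
  admissible \<open>w\<close> gives a smaller weighted sum than \<open>x\<close>, and for
  \<open>x\<close> each term is bounded separately.\<close>

lemma weighted_sum_ge_harm:
  fixes \<gamma> K :: real and w :: "nat \<Rightarrow> real"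
  assumes "0 < \<gamma>" "\<gamma> < 1" "0 \<le> K"
    and w: "\<And>h. 1 \<le> h \<Longrightarrow> h \<le> n \<Longrightarrow> K * real h powr \<gamma> \<le> (\<Sum>j<h. w j)"
  shows "K * \<gamma> * harm n \<le> (\<Sum>j<n. real (Suc j) powr (- \<gamma>) * w j)"
proof -
  define b where "b j = real (Suc j) powr (- \<gamma>)" for j
  \<comment> \<open>Increments of the required lower bound; they telescope, and
    \<open>0 powr \<gamma> = 0\<close> makes the sum start from 0.\<close>
  define x where "x j = K * (real (Suc j) powr \<gamma> - real j powr \<gamma>)" for j
  have x_sum: "(\<Sum>j<h. x j) = K * real h powr \<gamma>" for h
    unfolding x_def sum_distrib_left[symmetric]
    by (subst sum_lessThan_telescope) simp
  have prefix: "0 \<le> (\<Sum>j<h. w j - x j)" if "h \<le> n" for h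
    using w[of h] that by (cases "h = 0") (auto simp: sum_subtractf x_sum)
  have "antimono b"
    unfolding b_def antimono_def using assms by (auto intro!: powr_mono2')
  then have "b n * (\<Sum>j<n. w j - x j) \<le> (\<Sum>j<n. b j * (w j - x j))"
    using prefix by (rule antimono_weighted_sum_ge)
  moreover have "0 \<le> b n * (\<Sum>j<n. w j - x j)"
    using prefix[of n] by (simp add: b_def)
  ultimately have "(\<Sum>j<n. b j * x j) \<le> (\<Sum>j<n. b j * w j)"
    by (simp add: right_diff_distrib sum_subtractf)
  moreover have "K * \<gamma> * (1 / real (Suc j)) \<le> b j * x j" for j
  proof -
    \<comment> \<open>In terms of this ratio the term \<open>b j * x j\<close> is
      \<open>K * (1 - u powr \<gamma>)\<close>, so the tangent at 1 produces the harmonic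
      term.\<close>
    define u where "u = real j / real (Suc j)"
    have u: "0 \<le> u" "u - 1 = - 1 / real (Suc j)"
      by (auto simp: u_def field_simps)
    have "u powr \<gamma> \<le> 1 + \<gamma> * (u - 1)"
      using powr_le_tangent_at_one u(1) assms by blast
    then have "\<gamma> * (1 / real (Suc j)) \<le> 1 - u powr \<gamma>"
      unfolding u(2) by simp
    also have "\<dots> = b j * (real (Suc j) powr \<gamma> - real j powr \<gamma>)"
      by (simp add: u_def b_def powr_divide powr_minus_divide field_simps)
    finally have "K * (\<gamma> * (1 / real (Suc j))) \<le> K * (b j * (real (Suc j) powr \<gamma> - real j powr \<gamma>))"
      using assms(3) by (rule mult_left_mono)
    then show ?thesis
      by (simp add: x_def mult_ac)
  qed
  then have "(\<Sum>j<n. K * \<gamma> * (1 / real (Suc j))) \<le> (\<Sum>j<n. b j * x j)"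
    by (rule sum_mono)
  ultimately show ?thesis
    by (simp add: b_def harm_eq_sum_lessThan sum_distrib_left)
qed

text \<open>The numerical core: \<open>w j\<close> stands for the integral of the
  \<open>j\<close>-th ranked speed over the first \<open>T\<close> time units and \<open>E\<close>
  for the energy spent then. If all prefix sums were large, one well-chosen \<open>\<beta>\<close>
  in the hypothesis would force \<open>T + E \<le> E\<close>.\<close>

lemma exists_slow_parallelism:
  fixes \<alpha> T E :: real and w :: "nat \<Rightarrow> real"
  assumes \<alpha>: "1 < \<alpha>" and P: "2 \<le> P" and T: "0 < T" and E: "0 \<le> E"
    and power: "\<And>\<beta>. 0 < \<beta> \<Longrightarrow> (1 - \<alpha>) * \<beta> powr \<alpha> * harm P * T
      + \<alpha> * \<beta> powr (\<alpha> - 1) * (\<Sum>j<P. real (Suc j) powr (1 / \<alpha> - 1) * w j) \<le> E"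
  shows "\<exists>h. 1 \<le> h \<and> h \<le> P \<and>
    (\<alpha> - 1) powr (1 / \<alpha>) / 2 * ln (real P) powr (1 / \<alpha>) * real h powr (1 / \<alpha> - 1) * (\<Sum>j<h. w j)
      \<le> T + E"
proof (rule ccontr)
  define \<gamma> where "\<gamma> = 1 - 1 / \<alpha>"
  have \<gamma>: "0 < \<gamma>" "\<gamma> < 1" "1 / \<alpha> - 1 = - \<gamma>" "\<alpha> * \<gamma> = \<alpha> - 1"
    using \<alpha> by (auto simp: \<gamma>_def field_simps)
  \<comment> \<open>Half of \<open>M\<close> is the factor in the claim that depends only on
    \<alpha> and \<open>P\<close>.\<close>
  define M where "M = ((\<alpha> - 1) * ln (real P)) powr (1 / \<alpha>)"
  have lnP: "0 < ln (real P)"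
    using P by simp
  have M: "0 < M" "M powr \<alpha> = (\<alpha> - 1) * ln (real P)"
    using \<alpha> lnP by (auto simp: M_def powr_powr)
  \<comment> \<open>Chosen so that the negated claim reads as prefix sums of at least
    \<open>2 * \<beta> * T * h powr \<gamma>\<close>, while
    \<open>(\<beta> * M) powr \<alpha>\<close> is \<open>(1 + E / T) powr \<alpha>\<close>.\<close>
  define \<beta> where "\<beta> = (1 + E / T) / M"
  have \<beta>: "0 < \<beta>"
    using M T E by (simp add: \<beta>_def add_pos_nonneg)
  have split: "(\<alpha> - 1) powr (1 / \<alpha>) * ln (real P) powr (1 / \<alpha>) = M"
    using \<alpha> lnP by (simp add: M_def powr_mult)
  assume neg: "\<not> ?thesis"
  have "2 * \<beta> * T * real h powr \<gamma> \<le> (\<Sum>j<h. w j)" if "1 \<le> h" "h \<le> P" for h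
  proof -
    have "T + E < M / 2 * real h powr (- \<gamma>) * (\<Sum>j<h. w j)"
      using neg that unfolding \<gamma>(3) split[symmetric] by force
    moreover have "0 < real h powr \<gamma>"
      using that by simp
    ultimately have "2 * (T + E) / M * real h powr \<gamma> \<le> (\<Sum>j<h. w j)"
      using M(1) by (simp add: powr_minus field_simps)
    moreover have "2 * \<beta> * T = 2 * (T + E) / M"
      using M(1) T by (simp add: \<beta>_def field_simps)
    ultimately show ?thesis
      by (simp only:)
  qed
  then have "2 * \<beta> * T * \<gamma> * harm P \<le> (\<Sum>j<P. real (Suc j) powr (- \<gamma>) * w j)"
    using \<gamma> \<beta> T by (intro weighted_sum_ge_harm) auto
  then have "\<alpha> * \<beta> powr (\<alpha> - 1) * (2 * \<beta> * T * \<gamma> * harm P)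
      \<le> \<alpha> * \<beta> powr (\<alpha> - 1) * (\<Sum>j<P. real (Suc j) powr (1 / \<alpha> - 1) * w j)"
    unfolding \<gamma>(3) using \<alpha> by (intro mult_left_mono) auto
  with power[OF \<beta>] have "(1 - \<alpha>) * \<beta> powr \<alpha> * harm P * T
      + \<alpha> * \<beta> powr (\<alpha> - 1) * (2 * \<beta> * T * \<gamma> * harm P) \<le> E"
    by linarith
  \<comment> \<open>Because \<open>\<alpha> * \<gamma> = \<alpha> - 1\<close>, the weighted term is
    twice the absolute value of the negative term; one copy survives the cancellation.\<close>
  moreover have "\<beta> powr (\<alpha> - 1) * \<beta> = \<beta> powr \<alpha>"
    using \<beta> by (simp add: powr_diff)
  then have "\<alpha> * \<beta> powr (\<alpha> - 1) * (2 * \<beta> * T * \<gamma> * harm P)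
      = 2 * (\<alpha> * \<gamma>) * \<beta> powr \<alpha> * T * harm P"
    by (simp add: mult_ac flip: \<open>\<beta> powr (\<alpha> - 1) * \<beta> = \<beta> powr \<alpha>\<close>)
  ultimately have upper: "(\<alpha> - 1) * \<beta> powr \<alpha> * harm P * T \<le> E"
    unfolding \<gamma>(4) by (simp add: algebra_simps)
  \<comment> \<open>Since \<open>M powr \<alpha>\<close> is \<open>(\<alpha> - 1) * ln P\<close> and
    \<open>ln P \<le> harm P\<close>, the surviving copy is at least \<open>T + E\<close>,
    contradicting \<open>upper\<close>.\<close>
  have "1 + E / T \<le> (1 + E / T) powr \<alpha>"
    using \<alpha> T E powr_mono[of 1 \<alpha> "1 + E / T"] by simp
  also have "\<dots> = \<beta> powr \<alpha> * ((\<alpha> - 1) * ln (real P))"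
    using M T E \<alpha> lnP by (simp add: \<beta>_def powr_divide)
  also have "\<dots> \<le> \<beta> powr \<alpha> * ((\<alpha> - 1) * harm P)"
  proof -
    have "ln (real P) \<le> ln (real P + 1)"
      using P by simp
    then have "ln (real P) \<le> harm P"
      using ln_le_harm[of P] by linarith
    then show ?thesis
      using \<alpha> by (intro mult_left_mono) auto
  qed
  finally have "(1 + E / T) * T \<le> \<beta> powr \<alpha> * ((\<alpha> - 1) * harm P) * T"
    using T by (intro mult_right_mono) auto
  with upper have "(1 + E / T) * T \<le> E"
    by (simp add: mult_ac)
  moreover have "(1 + E / T) * T = T + E"
    using T by (simp add: distrib_right)
  ultimately show False
    using T by linarith
qed

section \<open>Schedules for a single job with one phase\<close>

definition single_job :: "real \<Rightarrow> nat \<Rightarrow> job list" where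
  "single_job W h =
     [\<lparr>release = 0, phases = [\<lparr>work = W, parallelism = ereal (real h)\<rparr>]\<rparr>]"

text \<open>The parallelism is an argument separate from any job, so that one schedule can be
  evaluated at every parallelism.\<close>

definition work_done :: "nat \<Rightarrow> schedule \<Rightarrow> nat \<Rightarrow> real \<Rightarrow> ennreal" where
  "work_done P S h t =
     (\<integral>\<^sup>+u \<in> {0..t}. ennreal (exec_rate P S 0 (ereal (real h)) u) \<partial>lborel)"

lemma job_set_single_job: "0 < W \<Longrightarrow> 1 \<le> h \<Longrightarrow> job_set (single_job W h)"
  by (simp add: job_set_def valid_job_def single_job_def)

lemma completion_single_job:
  "completion P (single_job W h) S 0
    = (INF t \<in> {t. 0 \<le> t \<and> ennreal W \<le> work_done P S h t}. ereal t)"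
  by (simp add: completion_def single_job_def work_done_def)

lemma completion_single_job_nonneg: "0 \<le> completion P (single_job W h) S 0"
  unfolding completion_single_job by (rule INF_greatest) auto

lemma completion_single_job_le:
  "0 \<le> t \<Longrightarrow> ennreal W \<le> work_done P S h t \<Longrightarrow> completion P (single_job W h) S 0 \<le> ereal t"
  unfolding completion_single_job by (rule INF_lower) simp

lemma active_single_job:
  "active P (single_job W h) S t
    = (if 0 \<le> t \<and> ereal t < completion P (single_job W h) S 0 then {0} else {})"
  by (auto simp: active_def single_job_def)

lemma cost_single_job:
  "cost \<alpha> P (single_job W h) S = completion P (single_job W h) S 0 + enn2ereal (energy \<alpha> P S)"
  by (simp add: cost_def flow_time_def single_job_def zero_ereal_def[symmetric])

lemma cost_single_job_infinite:
  "energy \<alpha> P S = \<infinity> \<Longrightarrow> cost \<alpha> P (single_job W h) S = \<infinity>"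
  using completion_single_job_nonneg[of P W h S] by (auto simp: cost_single_job)

context
  fixes P :: nat and S :: schedule and W :: real and h :: nat
  assumes valid: "valid_schedule P (single_job W h) S"
begin

lemma ranked_speed_measurable [measurable]: "ranked_speed P S 0 j \<in> borel_measurable borel"
  using valid by (intro borel_measurable_ranked_speed) (auto simp: valid_schedule_def)

lemma ranked_speed_ge_0: "0 \<le> ranked_speed P S 0 j t"
  using valid by (intro ranked_speed_nonneg) (auto simp: valid_schedule_def)

lemma exec_rate_measurable [measurable]:
  "exec_rate P S 0 (ereal (real k)) \<in> borel_measurable borel"
  unfolding exec_rate_eq_sum_ranked_speed by measurable

lemma exec_rate_mono:
  "k \<le> l \<Longrightarrow> exec_rate P S 0 (ereal (real k)) t \<le> exec_rate P S 0 (ereal (real l)) t"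
  unfolding exec_rate_eq_sum_ranked_speed
  by (rule sum_mono2) (auto simp: ranked_speed_ge_0)

lemma power_eq: "total_power \<alpha> P S t = (\<Sum>j<P. ranked_speed P S 0 j t powr \<alpha>)"
proof (rule total_power_eq_sum_ranked_speed)
  fix p assume "p < P" "assign S p t \<noteq> Some 0"
  with valid show "speed S p t = 0"
    by (cases "assign S p t") (auto simp: valid_schedule_def single_job_def)
qed

lemma total_power_measurable [measurable]: "total_power \<alpha> P S \<in> borel_measurable borel"
  unfolding power_eq by measurable

text \<open>A speed is at most 1 or at most its own power. This domination turns finite energy into
  integrability of the speeds on bounded intervals.\<close>

lemma ranked_speed_le_power:
  assumes "1 < \<alpha>" "j < P"
  shows "ranked_speed P S 0 j t \<le> 1 + total_power \<alpha> P S t"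
proof -
  let ?s = "ranked_speed P S 0 j t"
  have "?s \<le> 1 + ?s powr \<alpha>"
    using powr_mono[of 1 \<alpha> ?s] assms by (cases "?s \<le> 1") (auto intro: order_trans)
  also have "?s powr \<alpha> \<le> total_power \<alpha> P S t"
    unfolding power_eq using assms by (intro member_le_sum) auto
  finally show ?thesis
    by simp
qed

lemma total_power_nonneg: "0 \<le> total_power \<alpha> P S t"
  by (simp add: total_power_def sum_nonneg)

lemma integrable_total_power:
  assumes "energy \<alpha> P S < \<infinity>"
  shows "set_integrable lborel {0..t} (total_power \<alpha> P S)"
  unfolding set_integrable_def
proof (rule integrableI_nonneg)
  have "(\<integral>\<^sup>+u. ennreal (indicator {0..t} u *\<^sub>R total_power \<alpha> P S u) \<partial>lborel) \<le> energy \<alpha> P S"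
    unfolding energy_def
    by (intro nn_integral_mono) (auto split: split_indicator)
  with assms show "(\<integral>\<^sup>+u. ennreal (indicator {0..t} u *\<^sub>R total_power \<alpha> P S u) \<partial>lborel) < \<infinity>"
    by order
qed (auto simp: total_power_nonneg)

lemma integrable_ranked_speed:
  assumes "1 < \<alpha>" "energy \<alpha> P S < \<infinity>" "j < P"
  shows "set_integrable lborel {0..t} (ranked_speed P S 0 j)"
proof (rule set_integrable_bound)
  show "set_integrable lborel {0..t} (\<lambda>u. 1 + total_power \<alpha> P S u)"
    by (intro set_integral_add(1) integrable_total_power[OF assms(2)]
        borel_integrable_atLeastAtMost' continuous_on_const)
  show "set_borel_measurable lborel {0..t} (ranked_speed P S 0 j)"
    unfolding set_borel_measurable_def by measurable
  show "AE u in lborel. u \<in> {0..t} \<longrightarrow>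
      norm (ranked_speed P S 0 j u) \<le> norm (1 + total_power \<alpha> P S u)"
    using ranked_speed_le_power[OF assms(1,3)] ranked_speed_ge_0
    by (auto simp: abs_of_nonneg intro: order_trans[OF _ abs_ge_self])
qed

text \<open>Finite energy makes the speeds integrable, so work becomes a finite real: the prefix
  sums of the integrated ranked speeds.\<close>

lemma work_done_eq:
  assumes "1 < \<alpha>" "energy \<alpha> P S < \<infinity>" "k \<le> P"
  shows "work_done P S k t = ennreal (\<Sum>j<k. LINT u:{0..t}|lborel. ranked_speed P S 0 j u)"
proof -
  have int: "set_integrable lborel {0..t} (ranked_speed P S 0 j)" if "j < k" for j
    using integrable_ranked_speed[OF assms(1,2)] assms(3) that by simp
  have "work_done P S k t
      = (\<integral>\<^sup>+u. ennreal (\<Sum>j<k. indicator {0..t} u *\<^sub>R ranked_speed P S 0 j u) \<partial>lborel)"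
    unfolding work_done_def exec_rate_eq_sum_ranked_speed scaleR_sum_right[symmetric]
    by (intro nn_integral_cong) (simp add: indicator_def)
  also have "\<dots> = ennreal (LINT u|lborel. (\<Sum>j<k. indicator {0..t} u *\<^sub>R ranked_speed P S 0 j u))"
    using int unfolding set_integrable_def
    by (intro nn_integral_eq_integral Bochner_Integration.integrable_sum AE_I2 sum_nonneg)
       (auto simp: ranked_speed_ge_0)
  also have "(LINT u|lborel. (\<Sum>j<k. indicator {0..t} u *\<^sub>R ranked_speed P S 0 j u))
      = (\<Sum>j<k. LINT u:{0..t}|lborel. ranked_speed P S 0 j u)"
    unfolding set_lebesgue_integral_def
    using int unfolding set_integrable_def by (intro Bochner_Integration.integral_sum) auto
  finally show ?thesis .
qed

lemma work_done_mono: "s \<le> t \<Longrightarrow> work_done P S k s \<le> work_done P S k t"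
  unfolding work_done_def by (rule nn_set_integral_set_mono) auto

text \<open>Continuity from above of the measure whose density is the execution rate, along
  intervals shrinking to \<open>{0..T}\<close>; finite energy keeps their measures finite.\<close>

lemma work_done_right_continuous:
  assumes "1 < \<alpha>" "energy \<alpha> P S < \<infinity>" "k \<le> P"
    and ge: "\<And>t. T < t \<Longrightarrow> x \<le> work_done P S k t"
  shows "x \<le> work_done P S k T"
proof -
  define M where "M = density lborel (\<lambda>u. ennreal (exec_rate P S 0 (ereal (real k)) u))"
  have M: "emeasure M {0..t} = work_done P S k t" for t
    unfolding M_def work_done_def by (subst emeasure_density) auto
  define A where "A n = {0..T + 1 / real (Suc n)}" for n
  have "(\<Inter>n. A n) = {0..T}"
  proof (intro set_eqI iffI)
    fix u assume u: "u \<in> (\<Inter>n. A n)"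
    have "u \<le> T"
    proof (rule field_le_epsilon)
      fix e :: real assume "0 < e"
      then obtain n where "1 / real (Suc n) < e"
        by (rule nat_approx_posE)
      moreover have "u \<le> T + 1 / real (Suc n)"
        using u by (auto simp: A_def)
      ultimately show "u \<le> T + e"
        by linarith
    qed
    then show "u \<in> {0..T}"
      using u by (auto simp: A_def)
  qed (auto simp: A_def intro: order_trans)
  moreover have "(INF n. emeasure M (A n)) = emeasure M (\<Inter>n. A n)"
  proof (rule INF_emeasure_decseq)
    show "decseq A"
      unfolding decseq_def A_def by (auto simp: field_simps intro: order_trans)
    show "emeasure M (A n) \<noteq> \<infinity>" for n
      unfolding A_def M work_done_eq[OF assms(1,2,3)] by simp
  qed (auto simp: M_def A_def)
  moreover have "x \<le> (INF n. emeasure M (A n))"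
    unfolding A_def M by (intro INF_greatest ge) simp
  ultimately show ?thesis
    by (simp add: M)
qed

text \<open>Enough work is done by every time after the infimum that defines completion;
  right-continuity carries this over to the infimum itself.\<close>

lemma completion_single_job_attained:
  assumes "1 < \<alpha>" "energy \<alpha> P S < \<infinity>" "h \<le> P"
  obtains T where "0 \<le> T" "completion P (single_job W h) S 0 = ereal T"
    "ennreal W \<le> work_done P S h T"
proof -
  let ?C = "completion P (single_job W h) S 0"
  have "?C < \<infinity>"
    using valid by (auto simp: valid_schedule_def single_job_def)
  then obtain T where T: "?C = ereal T" "0 \<le> T"
    using completion_single_job_nonneg[of P W h S] by (cases ?C) auto
  have "ennreal W \<le> work_done P S h t" if "T < t" for t
  proof -
    have "?C < ereal t"
      using T that by simp
    then obtain s where "ennreal W \<le> work_done P S h s" "s < t"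
      unfolding completion_single_job INF_less_iff by auto
    then show ?thesis
      using work_done_mono[of s t h] by (meson less_imp_le order_trans)
  qed
  then have "ennreal W \<le> work_done P S h T"
    by (rule work_done_right_continuous[OF assms])
  with T that show ?thesis
    by blast
qed

end

text \<open>Without progress at parallelism \<open>l\<close> the rate integrates to zero on
  \<open>{s<..t}\<close>, and rates at lower parallelism are pointwise smaller.\<close>

lemma work_done_stalled:
  assumes "valid_schedule P (single_job W h) S" "1 < \<alpha>" "energy \<alpha> P S < \<infinity>"
    and "k \<le> l" "l \<le> P" "0 \<le> s" "s \<le> t" "work_done P S l t \<le> work_done P S l s"
  shows "work_done P S k t = work_done P S k s"
proof -
  note meas [measurable] = exec_rate_measurable[OF assms(1)]
  have split: "work_done P S m t = work_done P S m s
      + (\<integral>\<^sup>+u \<in> {s<..t}. ennreal (exec_rate P S 0 (ereal (real m)) u) \<partial>lborel)" for m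
  proof -
    have "{0..t} = {0..s} \<union> {s<..t}"
      using assms by auto
    then show ?thesis
      unfolding work_done_def by (simp only:) (subst nn_integral_disjoint_pair, auto)
  qed
  \<comment> \<open>Finiteness permits cancelling the work up to \<open>s\<close>.\<close>
  have "work_done P S l s < top"
    using work_done_eq[OF assms(1-3,5)] by simp
  then have "(\<integral>\<^sup>+u \<in> {s<..t}. ennreal (exec_rate P S 0 (ereal (real l)) u) \<partial>lborel) = 0"
    using assms(8) unfolding split[of l]
    by (metis add.right_neutral add_le_cancel_left ennreal_add_left_cancel_le le_zero_eq
        infinity_ennreal_def less_irrefl)
  moreover have "(\<integral>\<^sup>+u \<in> {s<..t}. ennreal (exec_rate P S 0 (ereal (real k)) u) \<partial>lborel)
      \<le> (\<integral>\<^sup>+u \<in> {s<..t}. ennreal (exec_rate P S 0 (ereal (real l)) u) \<partial>lborel)"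
    by (intro nn_integral_mono mult_right_mono ennreal_leI exec_rate_mono[OF assms(1)] assms) auto
  ultimately show ?thesis
    by (simp add: split[of k])
qed

text \<open>The pointwise tangent bound integrated over \<open>{0..T}\<close>; this supplies the
  hypothesis \<open>power\<close> of \<open>exists_slow_parallelism\<close>.\<close>

lemma integral_total_power_ge:
  assumes valid: "valid_schedule P (single_job W h) S"
    and \<alpha>: "1 < \<alpha>" and fin: "energy \<alpha> P S < \<infinity>" and "0 \<le> T" "0 < \<beta>"
  shows "(1 - \<alpha>) * \<beta> powr \<alpha> * harm P * T
      + \<alpha> * \<beta> powr (\<alpha> - 1) * (\<Sum>j<P. real (Suc j) powr (1 / \<alpha> - 1) *
          (LINT u:{0..T}|lborel. ranked_speed P S 0 j u))
    \<le> (LINT u:{0..T}|lborel. total_power \<alpha> P S u)"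
proof -
  define C where "C = (1 - \<alpha>) * \<beta> powr \<alpha> * harm P"
  define D where "D = \<alpha> * \<beta> powr (\<alpha> - 1)"
  define g where "g j u = indicator {0..T} u *\<^sub>R ranked_speed P S 0 j u" for j u
  define f where "f u = C * indicator {0..T} u
      + D * (\<Sum>j<P. real (Suc j) powr (1 / \<alpha> - 1) * g j u)" for u
  have "has_bochner_integral lborel (indicator {0..T} :: real \<Rightarrow> real) (measure lborel {0..T})"
    by (intro has_bochner_integral_real_indicator) (auto simp: emeasure_lborel_Icc_eq)
  then have ind: "has_bochner_integral lborel (indicator {0..T} :: real \<Rightarrow> real) T"
    using \<open>0 \<le> T\<close> by simp
  have g: "has_bochner_integral lborel (g j) (LINT u:{0..T}|lborel. ranked_speed P S 0 j u)"
    if "j < P" for j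
    using integrable_ranked_speed[OF valid \<alpha> fin that, of T]
    unfolding g_def set_lebesgue_integral_def set_integrable_def
    by (rule has_bochner_integral_integrable)
  have f: "has_bochner_integral lborel f (C * T
      + D * (\<Sum>j<P. real (Suc j) powr (1 / \<alpha> - 1) *
          (LINT u:{0..T}|lborel. ranked_speed P S 0 j u)))"
    unfolding f_def
    by (intro has_bochner_integral_add has_bochner_integral_mult_right ind
        has_bochner_integral_sum g) auto
  have "(LINT u|lborel. f u) \<le> (LINT u|lborel. indicator {0..T} u *\<^sub>R total_power \<alpha> P S u)"
  proof (rule integral_mono)
    show "integrable lborel f"
      using f by (rule integrable.intros)
    show "integrable lborel (\<lambda>u. indicator {0..T} u *\<^sub>R total_power \<alpha> P S u)"
      using integrable_total_power[OF valid fin] by (simp add: set_integrable_def)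
    fix u
    show "f u \<le> indicator {0..T} u *\<^sub>R total_power \<alpha> P S u"
    proof (cases "u \<in> {0..T}")
      case True
      then show ?thesis
        using sum_powr_ge_weighted_sum[OF \<alpha> \<open>0 < \<beta>\<close>, of "\<lambda>j. ranked_speed P S 0 j u" P,
            OF ranked_speed_ge_0[OF valid]]
        by (simp add: f_def g_def C_def D_def power_eq[OF valid])
    qed (simp add: f_def g_def)
  qed
  then show ?thesis
    using has_bochner_integral_integral_eq[OF f]
    by (simp add: set_lebesgue_integral_def C_def D_def)
qed

text \<open>Running \<open>h\<close> processors at speed \<open>h powr (- 1 / \<alpha>)\<close> makes their total power 1, so that energy
  equals flow time.\<close>

lemma opt_cost_single_job_le:
  assumes \<alpha>: "1 < \<alpha>" and h: "1 \<le> h" "h \<le> P" and W: "0 < W"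
  shows "opt_cost \<alpha> P (single_job W h) \<le> ereal (2 * W * real h powr (1 / \<alpha> - 1))"
proof -
  define \<sigma> where "\<sigma> = real h powr (- 1 / \<alpha>)"
  \<comment> \<open>The time in which \<open>h\<close> processors at speed \<open>\<sigma>\<close>,
    with joint rate \<open>h powr (1 - 1 / \<alpha>)\<close>, execute work \<open>W\<close>.\<close>
  define \<tau> where "\<tau> = W * real h powr (1 / \<alpha> - 1)"
  \<comment> \<open>Processors stay assigned after \<open>\<tau>\<close> at speed 0; none is
    assigned before the release at time 0.\<close>
  define S :: schedule where
    "S = \<lparr>assign = (\<lambda>p t. if p < h \<and> 0 \<le> t then Some 0 else None),
          speed = (\<lambda>p t. if p < h \<and> t \<in> {0..\<tau>} then \<sigma> else 0)\<rparr>"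
  have pos: "0 < \<sigma>" "0 < \<tau>"
    using h W by (auto simp: \<sigma>_def \<tau>_def)
  have \<sigma>\<alpha>: "real h * \<sigma> powr \<alpha> = 1"
    using \<alpha> h by (simp add: \<sigma>_def powr_powr powr_divide powr_minus_divide)
  have \<tau>: "real h * \<sigma> * \<tau> = W"
  proof -
    have "real h * \<sigma> * \<tau> = W * (real h powr 1 * real h powr (- 1 / \<alpha>) * real h powr (1 / \<alpha> - 1))"
      using h by (simp add: \<sigma>_def \<tau>_def)
    also have "\<dots> = W"
      using h unfolding powr_add[symmetric] by simp
    finally show ?thesis .
  qed
  have rate: "exec_rate P S 0 (ereal (real h)) t = real h * \<sigma>" if "t \<in> {0..\<tau>}" for t
  proof -
    have "filter (\<lambda>p. assign S p t = Some 0) [0..<P] = filter (\<lambda>p. p < h) ([0..<h] @ [h..<P])"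
      using that h upt_add_eq_append[of 0 h "P - h"] by (auto simp: S_def intro: filter_cong)
    also have "\<dots> = [0..<h]"
      by (simp add: filter_id_conv filter_empty_conv)
    finally have "speeds_desc P S 0 t = rev (sort (map (\<lambda>p. speed S p t) [0..<h]))"
      by (simp add: speeds_desc_def)
    also have "map (\<lambda>p. speed S p t) [0..<h] = replicate h \<sigma>"
      using that by (intro nth_equalityI) (auto simp: S_def)
    finally have "speeds_desc P S 0 t = replicate h \<sigma>"
      by (simp add: sorted_sort_id)
    then show ?thesis
      by (simp add: exec_rate_eq_sum_ranked_speed ranked_speed_def)
  qed
  have "work_done P S h \<tau> = (\<integral>\<^sup>+u \<in> {0..\<tau>}. ennreal (real h * \<sigma>) \<partial>lborel)"
    unfolding work_done_def by (intro set_nn_integral_cong) (auto simp: rate)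
  also have "\<dots> = ennreal W"
    using pos \<tau> by (simp add: nn_integral_cmult_indicator flip: ennreal_mult)
  finally have compl: "completion P (single_job W h) S 0 \<le> ereal \<tau>"
    using pos by (intro completion_single_job_le) auto
  have "valid_schedule P (single_job W h) S"
    unfolding valid_schedule_def
  proof (intro conjI allI impI)
    fix p i
    show "speed S p \<in> borel_measurable borel"
      by (simp add: S_def)
    have "{t. assign S p t = Some i} = (if p < h \<and> i = 0 then {0..} else {})"
      by (auto simp: S_def)
    then show "{t. assign S p t = Some i} \<in> sets borel"
      by auto
  next
    fix i assume "i < length (single_job W h)"
    then show "completion P (single_job W h) S i < \<infinity>"
      using le_less_trans[OF compl, of \<infinity>] by (simp add: single_job_def)
  qed (use pos in \<open>auto simp: S_def single_job_def split: if_splits\<close>)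
  then have "opt_cost \<alpha> P (single_job W h) \<le> cost \<alpha> P (single_job W h) S"
    unfolding opt_cost_def by (intro INF_lower) simp
  also have "\<dots> \<le> ereal \<tau> + ereal \<tau>"
    unfolding cost_single_job
  proof (intro add_mono compl)
    have "total_power \<alpha> P S t = indicator {0..\<tau>} t" for t
    proof -
      have "total_power \<alpha> P S t = (\<Sum>p<h. if t \<in> {0..\<tau>} then \<sigma> powr \<alpha> else 0)"
        unfolding total_power_def using h
        by (intro sum.mono_neutral_cong_right) (auto simp: S_def)
      then show ?thesis
        using \<sigma>\<alpha> by (simp add: indicator_def)
    qed
    then have "energy \<alpha> P S = (\<integral>\<^sup>+t. indicator {0..\<tau>} t \<partial>lborel)"
      unfolding energy_def by (intro nn_integral_cong) (auto simp: indicator_def)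
    also have "\<dots> = ennreal \<tau>"
      using pos by simp
    finally show "enn2ereal (energy \<alpha> P S) \<le> ereal \<tau>"
      using pos by (simp add: enn2ereal_ennreal)
  qed
  finally show ?thesis
    by (simp add: \<tau>_def mult.assoc)
qed

section \<open>Indistinguishable runs and the lower bound\<close>

text \<open>While neither job has completed, job 0 is the only active one in both runs at all times
  so far, so the observations coincide.\<close>

lemma nonclairvoyant_single_job_agree:
  assumes "nonclairvoyant P A" "job_set (single_job W h)" "job_set (single_job W' h')"
    and "0 \<le> t" "ereal t < completion P (single_job W h) (A (single_job W h)) 0"
    and "ereal t < completion P (single_job W' h') (A (single_job W' h')) 0"
  shows "exec_rate P (A (single_job W h)) i k t = exec_rate P (A (single_job W' h')) i k t"
    and "total_power \<alpha> P (A (single_job W h)) t = total_power \<alpha> P (A (single_job W' h')) t"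
proof -
  have "active P (single_job W h) (A (single_job W h)) u
      = active P (single_job W' h') (A (single_job W' h')) u" if "u \<in> {0..t}" for u
  proof -
    have "ereal u \<le> ereal t"
      using that by simp
    then have "ereal u < completion P (single_job W h) (A (single_job W h)) 0"
      "ereal u < completion P (single_job W' h') (A (single_job W' h')) 0"
      using assms(5,6) by order+
    then show ?thesis
      by (simp add: active_single_job)
  qed
  then have eq: "assign (A (single_job W h)) p t = assign (A (single_job W' h')) p t"
    "speed (A (single_job W h)) p t = speed (A (single_job W' h')) p t" if "p < P" for p
    using assms(1-4) that unfolding nonclairvoyant_def by blast+
  have "map (\<lambda>p. speed (A (single_job W h)) p t)
        (filter (\<lambda>p. assign (A (single_job W h)) p t = Some i) [0..<P])
      = map (\<lambda>p. speed (A (single_job W' h')) p t)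
        (filter (\<lambda>p. assign (A (single_job W' h')) p t = Some i) [0..<P])"
    using eq by (intro map_cong filter_cong) auto
  then show "exec_rate P (A (single_job W h)) i k t = exec_rate P (A (single_job W' h')) i k t"
    by (simp add: exec_rate_def speeds_desc_def)
  show "total_power \<alpha> P (A (single_job W h)) t = total_power \<alpha> P (A (single_job W' h')) t"
    using eq by (simp add: total_power_def)
qed

text \<open>Two runs agree only strictly before completion; the remaining endpoint is a null
  set.\<close>

lemma nn_set_integral_cong_atLeastLessThan:
  fixes f g :: "real \<Rightarrow> ennreal"
  assumes "\<And>u. 0 \<le> u \<Longrightarrow> u < t \<Longrightarrow> f u = g u"
  shows "(\<integral>\<^sup>+u \<in> {0..t}. f u \<partial>lborel) = (\<integral>\<^sup>+u \<in> {0..t}. g u \<partial>lborel)"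
  by (intro nn_integral_cong_AE eventually_mono[OF AE_lborel_singleton[of t]])
     (use assms in \<open>auto split: split_indicator\<close>)

theorem theorem5:
  fixes \<alpha> :: real
  assumes "1 < \<alpha>"
  shows "\<exists>c::real. 0 < c \<and>
    (\<forall>P::nat. 2 \<le> P \<longrightarrow>
      (\<forall>A. algorithm P A \<and> nonclairvoyant P A \<longrightarrow>
        (\<exists>J. job_set J \<and>
          ereal (c * ln (real P) powr (1 / \<alpha>)) * opt_cost \<alpha> P J \<le> cost \<alpha> P J (A J))))"
\<comment> \<open>Half of the constant in \<open>exists_slow_parallelism\<close>: the other factor 2
  is lost to the bound on the optimum, where energy doubles flow time.\<close>
proof (intro exI[of _ "(\<alpha> - 1) powr (1 / \<alpha>) / 4"] conjI allI impI)
  show "0 < (\<alpha> - 1) powr (1 / \<alpha>) / 4"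
    using assms by simp
next
  fix P :: nat and A
  assume P: "2 \<le> P" and "algorithm P A \<and> nonclairvoyant P A"
  then have A: "algorithm P A" "nonclairvoyant P A"
    by auto
  let ?G = "(\<alpha> - 1) powr (1 / \<alpha>) / 4 * ln (real P) powr (1 / \<alpha>)"
  show "\<exists>J. job_set J \<and> ereal ?G * opt_cost \<alpha> P J \<le> cost \<alpha> P J (A J)"
  \<comment> \<open>Infinite energy on some single job makes its cost infinite and the claim
    trivial; otherwise all the integrals below are finite.\<close>
  proof (cases "\<exists>W h. 0 < W \<and> 1 \<le> h \<and> energy \<alpha> P (A (single_job W h)) = \<infinity>")
    case True
    then obtain W h where "0 < W" "1 \<le> h" "energy \<alpha> P (A (single_job W h)) = \<infinity>"
      by blast
    then show ?thesis
      by (intro exI[of _ "single_job W h"]) (simp add: job_set_single_job cost_single_job_infinite)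
  next
    case False
    then have fin: "energy \<alpha> P (A (single_job W h)) < \<infinity>" if "0 < W" "1 \<le> h" for W h
      using that by (auto simp: less_top)
    have valid: "valid_schedule P (single_job W h) (A (single_job W h))"
      if "0 < W" "1 \<le> h" for W h
      using A(1) job_set_single_job[OF that] by (simp add: algorithm_def)
    define S where "S = A (single_job 1 1)"
    have S: "valid_schedule P (single_job 1 1) S" "energy \<alpha> P S < \<infinity>"
      using valid[of 1 1] fin[of 1 1] by (auto simp: S_def)
    obtain T where T: "0 \<le> T" "completion P (single_job 1 1) S 0 = ereal T"
        "ennreal 1 \<le> work_done P S 1 T"
      using completion_single_job_attained[OF S(1) assms S(2)] P by auto
    define w where "w j = (LINT u:{0..T}|lborel. ranked_speed P S 0 j u)" for j
    define E where "E = (LINT u:{0..T}|lborel. total_power \<alpha> P S u)"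
    have work: "work_done P S k T = ennreal (\<Sum>j<k. w j)" if "k \<le> P" for k
      using work_done_eq[OF S(1) assms S(2) that] by (simp add: w_def)
    have w_nonneg: "0 \<le> w j" for j
      unfolding w_def set_lebesgue_integral_def
      by (intro integral_nonneg_AE AE_I2) (simp add: ranked_speed_ge_0[OF S(1)])
    \<comment> \<open>A job of parallelism 1 uses only its fastest processor. This bound yields both
      \<open>T \<noteq> 0\<close> and a positive work \<open>W\<close>.\<close>
    have "1 \<le> w 0"
      using T(3) work[of 1] P by (simp del: ennreal_1 add: ennreal_le_iff2)
    have "T \<noteq> 0"
    proof
      assume "T = 0"
      then have "w 0 = (LINT u:{0}|lborel. ranked_speed P S 0 0 u)"
        by (simp add: w_def)
      also have "\<dots> = 0"
        unfolding set_lebesgue_integral_def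
        by (intro integral_eq_zero_AE eventually_mono[OF AE_lborel_singleton[of 0]]) auto
      finally show False
        using \<open>1 \<le> w 0\<close> by simp
    qed
    with T have "0 < T"
      by simp
    have "0 \<le> E"
      unfolding E_def set_lebesgue_integral_def
      by (intro integral_nonneg_AE AE_I2) (simp add: total_power_nonneg[OF S(1)])
    obtain h where h: "1 \<le> h" "h \<le> P" and slow: "(\<alpha> - 1) powr (1 / \<alpha>) / 2 * ln (real P) powr (1 / \<alpha>)
        * real h powr (1 / \<alpha> - 1) * (\<Sum>j<h. w j) \<le> T + E"
      using exists_slow_parallelism[OF assms P \<open>0 < T\<close> \<open>0 \<le> E\<close>, of w]
        integral_total_power_ge[OF S(1) assms S(2) T(1)]
      unfolding w_def E_def by blast
    \<comment> \<open>Exactly the work that the reference run \<open>S\<close> would complete by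
      \<open>T\<close> at parallelism \<open>h\<close>, so that the run on the new job cannot be
      told apart from \<open>S\<close> before \<open>T\<close>.\<close>
    define W where "W = (\<Sum>j<h. w j)"
    have "w 0 \<le> W"
      unfolding W_def using h w_nonneg by (intro member_le_sum) auto
    with \<open>1 \<le> w 0\<close> have W: "0 < W"
      by simp
    define S' where "S' = A (single_job W h)"
    have S': "valid_schedule P (single_job W h) S'" "energy \<alpha> P S' < \<infinity>"
      using valid[OF W h(1)] fin[OF W h(1)] by (auto simp: S'_def)
    obtain T' where T': "0 \<le> T'" "completion P (single_job W h) S' 0 = ereal T'"
        "ennreal W \<le> work_done P S' h T'"
      using completion_single_job_attained[OF S'(1) assms S'(2) h(2)] by blast
    have rate_agree: "exec_rate P S' 0 (ereal (real h)) u = exec_rate P S 0 (ereal (real h)) u"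
      and power_agree: "total_power \<alpha> P S' u = total_power \<alpha> P S u"
      if "0 \<le> u" "u < T" "u < T'" for u
      using nonclairvoyant_single_job_agree[OF A(2) job_set_single_job[OF W h(1)]
          job_set_single_job[of 1 1], of u] that T(2) T'(2)
      by (auto simp: S_def S'_def)
    \<comment> \<open>Completion at an earlier \<open>T'\<close> would mean that \<open>S\<close>
      has extracted all of \<open>W\<close> by then. It would make no progress at parallelism
      \<open>h\<close> until \<open>T\<close>, hence none at parallelism 1, and the unit job would
      have completed by \<open>T'\<close> too.\<close>
    have "T \<le> T'"
    proof (rule ccontr)
      assume "\<not> T \<le> T'"
      then have "T' < T"
        by simp
      have "work_done P S h T = ennreal W"
        using work[OF h(2)] by (simp add: W_def)
      also have "\<dots> \<le> work_done P S' h T'"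
        by (rule T'(3))
      also have "\<dots> = work_done P S h T'"
        unfolding work_done_def using \<open>T' < T\<close>
        by (intro nn_set_integral_cong_atLeastLessThan) (simp add: rate_agree)
      finally have "work_done P S h T \<le> work_done P S h T'" .
      then have "work_done P S 1 T = work_done P S 1 T'"
        by (rule work_done_stalled[OF S(1) assms S(2) h T'(1) less_imp_le[OF \<open>T' < T\<close>]])
      then have "completion P (single_job 1 1) S 0 \<le> ereal T'"
        using T(3) T'(1) by (intro completion_single_job_le) auto
      with T(2) \<open>T' < T\<close> show False
        by simp
    qed
    have "ennreal E = (\<integral>\<^sup>+u \<in> {0..T}. ennreal (total_power \<alpha> P S u) \<partial>lborel)"
    proof -
      have "(\<integral>\<^sup>+u. ennreal (indicator {0..T} u *\<^sub>R total_power \<alpha> P S u) \<partial>lborel) = ennreal E"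
        unfolding E_def set_lebesgue_integral_def
        using integrable_total_power[OF S] total_power_nonneg[OF S(1)]
        by (intro nn_integral_eq_integral) (auto simp: set_integrable_def)
      moreover have "(\<integral>\<^sup>+u. ennreal (indicator {0..T} u *\<^sub>R total_power \<alpha> P S u) \<partial>lborel)
          = (\<integral>\<^sup>+u \<in> {0..T}. ennreal (total_power \<alpha> P S u) \<partial>lborel)"
        by (intro nn_integral_cong) (auto split: split_indicator)
      ultimately show ?thesis
        by simp
    qed
    \<comment> \<open>The runs coincide before \<open>T\<close>, so the new run also spends
      \<open>E\<close> by then.\<close>
    also have "\<dots> = (\<integral>\<^sup>+u \<in> {0..T}. ennreal (total_power \<alpha> P S' u) \<partial>lborel)"
      using \<open>T \<le> T'\<close> by (intro nn_set_integral_cong_atLeastLessThan) (simp add: power_agree)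
    also have "\<dots> \<le> energy \<alpha> P S'"
      unfolding energy_def by (rule nn_set_integral_set_mono) auto
    finally have "ereal E \<le> enn2ereal (energy \<alpha> P S')"
      using \<open>0 \<le> E\<close> by (metis enn2ereal_ennreal less_eq_ennreal.rep_eq)
    then have "ereal T + ereal E \<le> cost \<alpha> P (single_job W h) S'"
      unfolding cost_single_job T'(2) using \<open>T \<le> T'\<close> by (intro add_mono) auto
    moreover have "ereal ?G * opt_cost \<alpha> P (single_job W h)
        \<le> ereal ?G * ereal (2 * W * real h powr (1 / \<alpha> - 1))"
      by (intro ereal_mult_left_mono opt_cost_single_job_le assms h W) simp
    moreover have "ereal ?G * ereal (2 * W * real h powr (1 / \<alpha> - 1)) \<le> ereal T + ereal E"
      using slow by (simp add: W_def mult_ac)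
    ultimately have "ereal ?G * opt_cost \<alpha> P (single_job W h) \<le> cost \<alpha> P (single_job W h) S'"
      by order
    with job_set_single_job[OF W h(1)] show ?thesis
      unfolding S'_def by blast
  qed
qed

end
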